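(* Let $A_1,\dots,A_n$ be events in a probability space $(\Omega,\mathcal F,\mathbf P)$, let $r,d$ be integers with $1\le r\le n$ and $0\le d\le r$, and let $P_r$, $p_r$, $J_d$, $s_1(j)$, $s_2(j)$ ($j\in J_d$) be as defined in the context. Then the following hold. (i) If $r-d\ge 1$, then $$P_r\le \sum_{j\in J_d}\frac{s_2(j)}{C_r^{d+1}}\quad\text{and}\quad p_r\le \sum_{j\in J_d}\frac{s_2(j)}{C_r^{d+1}}.$$ (ii) If $n-r\ge 1$, then $$P_r\le \sum_{j\in J_d}\frac{(C_n^{d+1}-C_r^{d+1})s_1(j)-(C_n^d-C_r^d)s_2(j)}{C_n^{d+1}C_r^d-C_n^dC_r^{d+1}}\quad\text{and}\quad p_r\le \sum_{j\in J_d}\frac{C_n^{d+1}s_1(j)-C_n^d s_2(j)}{C_n^{d+1}C_r^d-C_n^dC_r^{d+1}}.$$ (iii) If $r-d\ge 1$, then $$P_r\ge \sum_{j\in J_d}\frac{-C_{r-1}^{d+1}s_1(j)+C_{r-1}^d s_2(j)}{C_n^{d+1}C_{r-1}^d-C_n^dC_{r-1}^{d+1}}\quad\text{and}\quad p_n\ge \sum_{j\in J_d}\frac{-C_{n-1}^{d+1}s_1(j)+C_{n-1}^d s_2(j)}{C_n^{d+1}C_{n-1}^d-C_n^dC_{n-1}^{d+1}}.$$ (iv) If $r=d\ge 1$ and $n-r\ge 1$, then $$P_d\ge \sum_{j\in J_d}\frac{(d+1)\,(m\,s_1(j)-d\,s_2(j))}{(m+d)\,C_{m+d-1}^d}\quad\text{and}\quad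 p_d\ge \sum_{j\in J_d}\bigl(s_1(j)-(d+1)s_2(j)\bigr),$$ where $m=m_j$ is any natural number with $1\le m\le n-d$, which may be chosen separately for each $j$. For given $j$, an optimal $m$ (one maximizing the $j$-th summand of the bound for $P_d$ over $1\le m\le n-d$) is, when $s_1(j)>0$, any $m\in\{1,\dots,n-d\}$ with $$m-1\le \frac{(d+1)s_2(j)}{s_1(j)}\le m,$$ and otherwise it is $1$ or $n-d$. (v) Let $\mathcal A\subset\mathcal F$ be a $\sigma$-field. All inequalities in (i)--(iv) hold almost surely if $P_r$, $p_r$ (and $p_n,P_d,p_d$) are replaced by the conditional probabilities $P_r^{\mathcal A}$, $p_r^{\mathcal A}$ (and $p_n^{\mathcal A},P_d^{\mathcal A},p_d^{\mathcal A}$) and $s_1(j),s_2(j)$ are replaced by $s_1^{\mathcal A}(j),s_2^{\mathcal A}(j)$.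
   Context: $C_u^v=\binom{u}{v}$ is the binomial coefficient, with $C_u^v=0$ for $v>u\ge 0$ and $C_u^0=1$. For events $A_1,\dots,A_n$, $B_i$ is the event that exactly $i$ of them occur ($i=0,\dots,n$) and $U_r=\bigcup_{i=r}^n B_i$ is the event that at least $r$ of them occur. Put $p_i=\mathbf P(B_i)$, $P_r=\mathbf P(U_r)=\sum_{i=r}^n p_i$. For a $\sigma$-field $\mathcal A\subset\mathcal F$, $p_i^{\mathcal A}=\mathbf P(B_i\mid\mathcal A)$ and $P_r^{\mathcal A}=\mathbf P(U_r\mid\mathcal A)$. For $1\le d\le n$, $J_d$ is the set of $j=(j_1,\dots,j_d)\in\mathbb N^d$ with $1\le j_1<\dots<j_d\le n$; $J_0=\{0\}$. For $j\in J_d$ write $A_{j_1}\cdots A_{j_d}$ for the intersection (equal to $\Omega$ if $d=0$), and $p_{i,j}=\mathbf P(B_i\cap A_{j_1}\cdots A_{j_d})$. For $j\in J_d$ and $k=1,2$ define $$s_k(j)=\sum_{i=1}^{n-d+1} C_{i+d-1}^{k+d-1}\,\frac{p_{i+d-1,j}}{C_{i+d-1}^d}.$$ Equivalently, $$s_k(j)=\frac{d!}{(k+d-1)!}\sum \mathbf P\bigl(A_{u_1}\cdots A_{u_{k-1}}A_{j_1}\cdots A_{j_d}\bigr),$$ where the sum is over all ordered $(k-1)$-tuples of pairwise distinct indices $u_1,\dots,u_{k-1}\in\{1,\dots,n\}\setminus\{j_1,\dots,j_d\}$ (for $d=0$ over $\{1,\dots,n\}$); in particular $s_1(j)=\mathbf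 P(A_{j_1}\cdots A_{j_d})$. The random variables $s_k^{\mathcal A}(j)$ are defined by the right-hand side of the last formula with $\mathbf P(\cdot)$ replaced by $\mathbf P(\cdot\mid\mathcal A)$. *)

theory Defs
  imports "HOL-Probability.Probability"
begin

definition exactly_event :: "'a measure \<Rightarrow> (nat \<Rightarrow> 'a set) \<Rightarrow> nat \<Rightarrow> nat \<Rightarrow> 'a set" where
  "exactly_event M A n i = {\<omega> \<in> space M. card {l \<in> {1..n}. \<omega> \<in> A l} = i}"

definition at_least_event :: "'a measure \<Rightarrow> (nat \<Rightarrow> 'a set) \<Rightarrow> nat \<Rightarrow> nat \<Rightarrow> 'a set" where
  "at_least_event M A n r = (\<Union>i\<in>{r..n}. exactly_event M A n i)"

(* The strictly increasing d-tuples of indices in {1..n}; for d = 0 this is {[]}, a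
   set with one element. *)
definition index_tuples :: "nat \<Rightarrow> nat \<Rightarrow> nat list set" where
  "index_tuples n d = {j. length j = d \<and> sorted_wrt (<) j \<and> set j \<subseteq> {1..n}}"

(* Intersecting with the space makes the empty intersection equal to the sure event. *)
definition meet_event :: "'a measure \<Rightarrow> (nat \<Rightarrow> 'a set) \<Rightarrow> nat list \<Rightarrow> 'a set" where
  "meet_event M A j = space M \<inter> (\<Inter>l\<in>set j. A l)"

(* Meant for k >= 1 and j in index_tuples n d. It is the probability of the intersection
   along j, restricted to each possible number i + d - 1 of occurring events and weighted
   by a quotient of binomial coefficients; for k = 1 the weights are 1. *)
definition s_num :: "'a measure \<Rightarrow> (nat \<Rightarrow> 'a set) \<Rightarrow> nat \<Rightarrow> nat \<Rightarrow> nat list \<Rightarrow> real" where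
  "s_num M A n k j =
     (let d = length j in
      \<Sum>i = 1..n - d + 1.
        real ((i + d - 1) choose (k + d - 1)) *
        (measure M (exactly_event M A n (i + d - 1) \<inter> meet_event M A j)
           / real ((i + d - 1) choose d)))"

(* The conditional probability of E given the sigma-field of F (a subalgebra of M): one
   version of it, determined up to null sets. *)
definition cprob :: "'a measure \<Rightarrow> 'a measure \<Rightarrow> 'a set \<Rightarrow> 'a \<Rightarrow> real" where
  "cprob M F E = real_cond_exp M F (indicator E)"

(* Conditional counterpart of s_num, in its form as a sum over ordered (k-1)-tuples u of
   pairwise distinct indices that do not occur in j. *)
definition s_cond :: "'a measure \<Rightarrow> 'a measure \<Rightarrow> (nat \<Rightarrow> 'a set) \<Rightarrow> nat \<Rightarrow> nat \<Rightarrow> nat list \<Rightarrow> 'a \<Rightarrow> real" where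
  "s_cond M F A n k j \<omega> =
     (let d = length j in
      fact d / fact (k + d - 1) *
      (\<Sum>u \<in> {u. length u = k - 1 \<and> distinct u \<and> set u \<subseteq> {1..n} - set j}.
         cprob M F (meet_event M A (u @ j)) \<omega>))"

end

theory Submission
  imports Defs
begin

text \<open>Let \<open>N\<close> be the number of events that occur. At a sample point there are \<open>C(N, d)\<close> tuples
  \<open>j\<close> along which all events occur, so the sums over \<open>j\<close> of \<open>s\<^sub>1(j)\<close> and \<open>s\<^sub>2(j)\<close> are the expectations
  of \<open>C(N, d)\<close> and \<open>C(N, d+1)\<close>. Each bound is therefore an inequality between a combination of these two
  binomial coefficients and the indicator of \<open>N \<ge> r\<close> or \<open>N = r\<close>; in (iv) it is instead
  the convexity of \<open>t \<mapsto> 1/C(t+d, d)\<close>, applied to each \<open>j\<close> separately.\<close>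

section \<open>Identities and pointwise inequalities for the coefficients C(x, d) and C(x,
  d+1)\<close>

text \<open>Absorption. With the subtraction taken over the reals, \<open>x < d\<close> needs no
  exception, since both coefficients vanish there.\<close>

lemma real_binomial_Suc:
  "(real d + 1) * real (x choose (d + 1)) = (real x - real d) * real (x choose d)"
proof (cases "d \<le> x")
  case True
  have "Suc d * (x choose Suc d) = (x - d) * (x choose d)"
    by (metis binomial_absorb_comp binomial_absorption)
  then have "real (Suc d) * real (x choose Suc d) = real (x - d) * real (x choose d)"
    by (metis of_nat_mult)
  with True show ?thesis
    by (simp add: of_nat_diff add.commute)
qed (simp add: binomial_eq_0)

lemma real_binomial_Suc_divide:
  "real (x choose (d + 1)) = real (x choose d) * (real x - real d) / (real d + 1)"
  using real_binomial_Suc[of d x] by (simp add: eq_divide_eq mult.commute)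

text \<open>The denominators in (ii) and (iii) are determinants of this kind. As C(., d+1) is C(.,
  d) times a linear factor, the determinant factors and its sign can be read off.\<close>

lemma binomial_determinant:
  "real (a choose (d + 1)) * real (b choose d) - real (a choose d) * real (b choose (d + 1))
    = real (a choose d) * real (b choose d) * (real a - real b) / (real d + 1)"
proof -
  have "(real d + 1) * (real (a choose (d + 1)) * real (b choose d) - real (a choose d) * real (b choose (d + 1)))
      = ((real d + 1) * real (a choose (d + 1))) * real (b choose d)
        - real (a choose d) * ((real d + 1) * real (b choose (d + 1)))"
    by (simp add: algebra_simps)
  also have "\<dots> = real (a choose d) * real (b choose d) * (real a - real b)"
    unfolding real_binomial_Suc by (simp add: algebra_simps)
  finally show ?thesis
    by (simp add: eq_divide_eq mult.commute)
qed

lemma binomial_determinant_pos: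
  assumes "d \<le> b" "b < a"
  shows "0 < real (a choose (d + 1)) * real (b choose d) - real (a choose d) * real (b choose (d + 1))"
  unfolding binomial_determinant using assms by simp


text \<open>The increments of \<open>k \<mapsto> C(k, d+1)\<close> and \<open>k \<mapsto> C(k, d)\<close> have ratio \<open>(k-d+1)/d\<close>, which increases with
  \<open>k\<close>; so \<open>C(x, d+1)\<close> is a convex function of \<open>C(x, d)\<close> and lies below the chord from \<open>r\<close> to \<open>n\<close>.\<close>
lemma binomial_chord:
  assumes "r \<le> x" "x \<le> n"
  shows "(real (n choose d) - real (x choose d)) * (real (x choose (d + 1)) - real (r choose (d + 1)))
    \<le> (real (n choose (d + 1)) - real (x choose (d + 1))) * (real (x choose d) - real (r choose d))"
proof (cases d)
  case 0
  then show ?thesis by simp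
next
  case (Suc e)
  have ratio: "real d * real (k choose d) = (real k - real d + 1) * real (k choose e)" for k
    using real_binomial_Suc[of e k] Suc by (simp add: add.commute)
  have pascal: "real (Suc k choose d) = real (k choose d) + real (k choose e)"
    "real (Suc k choose (d + 1)) = real (k choose (d + 1)) + real (k choose d)" for k
    using Suc by simp_all
  \<comment> \<open>The slope (x-d)/d separates the increments: the ratio (k-d+1)/d is at most this
    for \<open>k < x\<close> and at least this for \<open>k \<ge> x\<close>. Multiplying
    \<open>low\<close> by \<open>V\<close> and \<open>up\<close> by \<open>U\<close> then gives a
    common middle term.\<close>
  have low: "real d * (real (x choose (d + 1)) - real (r choose (d + 1)))
      \<le> (real x - real d) * (real (x choose d) - real (r choose d))"
    using assms(1)
  proof (induction r rule: inc_induct)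
    case (step k)
    have "(real k - real d + 1) * real (k choose e) \<le> (real x - real d) * real (k choose e)"
      using step by (intro mult_right_mono) auto
    with step.IH show ?case
      using ratio[of k] unfolding pascal by (simp add: algebra_simps)
  qed simp
  have up: "(real x - real d) * (real (n choose d) - real (x choose d))
      \<le> real d * (real (n choose (d + 1)) - real (x choose (d + 1)))"
    using assms(2)
  proof (induction n rule: dec_induct)
    case (step k)
    have "(real x - real d) * real (k choose e) \<le> (real k - real d + 1) * real (k choose e)"
      using step by (intro mult_right_mono) auto
    with step.IH show ?case
      using ratio[of k] unfolding pascal by (simp add: algebra_simps)
  qed simp
  define U V where "U = real (x choose d) - real (r choose d)"
    and "V = real (n choose d) - real (x choose d)"
  have nonneg: "0 \<le> U" "0 \<le> V"
    using assms by (auto simp: U_def V_def binomial_right_mono)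
  have "V * (real d * (real (x choose (d + 1)) - real (r choose (d + 1)))) \<le> V * ((real x - real d) * U)"
    using low nonneg unfolding U_def by (intro mult_left_mono) auto
  also have "\<dots> \<le> real d * (real (n choose (d + 1)) - real (x choose (d + 1))) * U"
    using mult_right_mono[OF up nonneg(1)] by (simp add: V_def mult_ac)
  finally have "real d * (V * (real (x choose (d + 1)) - real (r choose (d + 1))))
      \<le> real d * ((real (n choose (d + 1)) - real (x choose (d + 1))) * U)"
    by (simp add: mult_ac)
  then show ?thesis
    using Suc by (simp add: U_def V_def)
qed

lemma tail_le_binomial:
  assumes "d < r"
  shows "of_bool (r \<le> x) \<le> real (x choose (d + 1)) / real (r choose (d + 1))"
  using assms by (auto simp: le_divide_eq binomial_right_mono)

text \<open>The right side is normalised to equal 1 at \<open>x = r\<close> and at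
  \<open>x = n\<close>. Convexity keeps it at least 1 in between; below \<open>r\<close> only
  nonnegativity is left to show.\<close>

lemma tail_le_chord:
  assumes "d \<le> r" "r < n" "x \<le> n"
  shows "of_bool (r \<le> x) \<le>
    ((real (n choose (d + 1)) - real (r choose (d + 1))) * real (x choose d)
      - (real (n choose d) - real (r choose d)) * real (x choose (d + 1)))
    / (real (n choose (d + 1)) * real (r choose d) - real (n choose d) * real (r choose (d + 1)))"
proof (cases "r \<le> x")
  case True
  show ?thesis
    using binomial_chord[OF True assms(3), of d] binomial_determinant_pos[OF assms(1,2)] True
    by (simp add: le_divide_eq algebra_simps)
next
  case False
  have mono: "real (r choose d) \<le> real (n choose d)"
    using assms by (simp add: binomial_right_mono)
  \<comment> \<open>The numerator is the determinant of (n, x) minus that of (r, x). Without the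
    common factor C(x, d)/(d+1) these are the two products here, which compare factor by
    factor.\<close>
  have "0 \<le> (real (n choose d) * (real n - real x) - real (r choose d) * (real r - real x))"
    using False assms mono by (intro diff_ge_0_iff_ge[THEN iffD2] mult_mono) auto
  then have "0 \<le> real (x choose d) * (real (n choose d) * (real n - real x) - real (r choose d) * (real r - real x))
      / (real d + 1)"
    by simp
  also have "\<dots> = (real (n choose (d + 1)) * real (x choose d) - real (n choose d) * real (x choose (d + 1)))
      - (real (r choose (d + 1)) * real (x choose d) - real (r choose d) * real (x choose (d + 1)))"
    unfolding binomial_determinant diff_divide_distrib[symmetric] by (simp add: algebra_simps)
  finally show ?thesis
    using binomial_determinant_pos[OF assms(1,2)] False by (simp add: algebra_simps)
qed

text \<open>A quotient of determinants, equal to 1 at \<open>x = r\<close> and 0 at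
  \<open>x = n\<close>; elsewhere its sign suffices.\<close>

lemma level_le_chord:
  assumes "d \<le> r" "r < n" "x \<le> n"
  shows "of_bool (x = r) \<le>
    (real (n choose (d + 1)) * real (x choose d) - real (n choose d) * real (x choose (d + 1)))
    / (real (n choose (d + 1)) * real (r choose d) - real (n choose d) * real (r choose (d + 1)))"
proof (cases "x = r")
  case True
  then show ?thesis
    using binomial_determinant_pos[OF assms(1,2)] by simp
next
  case False
  have "0 \<le> real (n choose (d + 1)) * real (x choose d) - real (n choose d) * real (x choose (d + 1))"
    unfolding binomial_determinant using assms by simp
  then show ?thesis
    using False binomial_determinant_pos[OF assms(1,2)] by simp
qed

text \<open>The quotient vanishes at \<open>x = r - 1\<close> and equals 1 at \<open>x = n\<close>.
  In factored form it is a nonnegative multiple of C(x, d) (x-r+1), which is at most 0 below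
  \<open>r\<close> and increases from \<open>r\<close> on.\<close>

lemma chord_le_tail:
  assumes "d < r" "r \<le> n" "x \<le> n"
  shows "(- real ((r - 1) choose (d + 1)) * real (x choose d) + real ((r - 1) choose d) * real (x choose (d + 1)))
    / (real (n choose (d + 1)) * real ((r - 1) choose d) - real (n choose d) * real ((r - 1) choose (d + 1)))
    \<le> of_bool (r \<le> x)"
proof -
  have pos: "0 < real (n choose (d + 1)) * real ((r - 1) choose d) - real (n choose d) * real ((r - 1) choose (d + 1))"
    using assms by (intro binomial_determinant_pos) auto
  have num: "- real ((r - 1) choose (d + 1)) * real (x choose d) + real ((r - 1) choose d) * real (x choose (d + 1))
      = real (x choose d) * real ((r - 1) choose d) * (real x - real (r - 1)) / (real d + 1)"
    unfolding binomial_determinant[symmetric] by (simp add: algebra_simps)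
  show ?thesis
  proof (cases "r \<le> x")
    case True
    have "real (x choose d) * real ((r - 1) choose d) * (real x - real (r - 1)) / (real d + 1)
        \<le> real (n choose d) * real ((r - 1) choose d) * (real n - real (r - 1)) / (real d + 1)"
      using assms True by (intro divide_right_mono mult_mono mult_right_mono) (auto simp: binomial_right_mono)
    then show ?thesis
      using pos True unfolding num unfolding binomial_determinant
      by (simp only: divide_le_eq_1_pos of_bool_eq)
  next
    case False
    then have "real (x choose d) * real ((r - 1) choose d) * (real x - real (r - 1)) / (real d + 1) \<le> 0"
      by (auto simp: divide_le_0_iff mult_le_0_iff)
    then show ?thesis
      using pos False unfolding num by (simp add: divide_le_0_iff)
  qed
qed

text \<open>The left side is C(x, d) (d+1-x): zero below \<open>d\<close>, 1 at \<open>d\<close>,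
  and at most 0 beyond.\<close>

lemma binomial_diff_le_level:
  assumes "1 \<le> d"
  shows "real (x choose d) - real (d + 1) * real (x choose (d + 1)) \<le> of_bool (x = d)"
proof -
  have "real (x choose d) - real (d + 1) * real (x choose (d + 1)) = real (x choose d) * (1 - (real x - real d))"
    using real_binomial_Suc[of d x] by (simp add: algebra_simps)
  also have "\<dots> \<le> of_bool (x = d)"
    by (cases "x = d"; cases "x < d") (auto simp: mult_le_0_iff binomial_eq_0)
  finally show ?thesis .
qed

section \<open>Secants of a convex sequence\<close>

text \<open>The line through the points \<open>(m-1, 1/C(m-1+d, d))\<close> and \<open>(m, 1/C(m+d, d))\<close> of the graph of
  the convex sequence \<open>t \<mapsto> 1/C(t+d, d)\<close>.\<close>
definition secant :: "nat \<Rightarrow> nat \<Rightarrow> real \<Rightarrow> real" where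
  "secant d m t = (real (d + 1) * real m - real d * t) / (real (m + d) * real ((m + d - 1) choose d))"

lemma secant_at:
  "secant d (t + 1) (real t) = 1 / real ((t + d) choose d)"
proof -
  have "real (d + 1) * real (t + 1) - real d * real t = real (t + 1 + d)"
    by (simp add: algebra_simps)
  then show ?thesis
    unfolding secant_def by simp
qed

text \<open>Consecutive secants share the graph point over \<open>t = m\<close>, and
  \<open>c\<close> is the increase in slope from one to the next; its sign expresses
  convexity.\<close>

lemma secant_diff:
  assumes "1 \<le> m"
  obtains c where "0 \<le> c" "\<And>t. secant d m t - secant d (m + 1) t = c * (real m - t)"
proof -
  define u where "u = real ((m + d - 1) choose d)"
  define v where "v = real ((m + d) choose d)"
  have u: "0 < u" and v: "0 < v"
    using assms by (auto simp: u_def v_def)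
  have "m * ((m + d) choose d) = (m + d) * ((m + d - 1) choose d)"
    using binomial_absorb_comp[of "m + d" d] by simp
  then have uv: "real m * v = real (m + d) * u"
    unfolding u_def v_def by (metis of_nat_mult)
  \<comment> \<open>Absorption (\<open>uv\<close>) makes both denominators multiples of
    \<open>v\<close> = C(m+d, d), so that the common value 1/v at \<open>t = m\<close> becomes
    visible.\<close>
  define q where "q = real m * v"
  define q' where "q' = real (m + 1 + d) * v"
  have q: "0 < q" "q \<le> q'" and q': "0 < q'"
    using assms v by (auto simp: q_def q'_def)
  have s: "secant d m t = (real (d + 1) * real m - real d * t) / q"
    "secant d (m + 1) t = (real (d + 1) * real (m + 1) - real d * t) / q'" for t
    unfolding secant_def q_def q'_def uv by (simp_all add: u_def v_def)
  have "q' = (real m + real d + 1) * v" "real m + real d + 1 \<noteq> 0"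
    by (simp_all add: q'_def)
  then have m: "real m / q = 1 / v" "(real m + real d + 1) / q' = 1 / v"
    using assms v by (simp_all add: q_def)
  show ?thesis
  proof
    show "0 \<le> real d / q - real d / q'"
      using q q' by (simp add: divide_left_mono)
    show "secant d m t - secant d (m + 1) t = (real d / q - real d / q') * (real m - t)" for t
    proof -
      have "secant d m t = real m / q + real d / q * (real m - t)"
        unfolding s using q by (simp add: field_simps)
      moreover have "secant d (m + 1) t = (real m + real d + 1) / q' + real d / q' * (real m - t)"
        unfolding s using q' by (simp add: field_simps)
      ultimately show ?thesis
        unfolding m by (simp add: algebra_simps)
    qed
  qed
qed

text \<open>By \<open>secant_diff\<close> the value at \<open>t\<close> does not decrease as the
  index k passes from k to k+1 while \<open>k \<le> t\<close>, and does not increase once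
  \<open>k \<ge> t\<close>. This serves both the bound in (iv) and the optimality of
  \<open>m\<close>.\<close>

lemma secant_max:
  assumes "1 \<le> m" "real m - 1 \<le> t" "t \<le> real m" "1 \<le> m'"
  shows "secant d m' t \<le> secant d m t"
proof (cases "m \<le> m'")
  case True
  then show ?thesis
  proof (induction m' rule: dec_induct)
    case (step k)
    obtain c where "0 \<le> c" "secant d k t - secant d (k + 1) t = c * (real k - t)"
      using secant_diff[of k d] step assms by (metis le_trans)
    moreover have "0 \<le> real k - t"
      using step assms by simp
    ultimately show ?case
      using step.IH by (smt (verit) Suc_eq_plus1 mult_nonneg_nonneg)
  qed simp
next
  case False
  then have "m' \<le> m" by simp
  then show ?thesis
    using assms(4)
  proof (induction m' rule: inc_induct)
    case (step k)
    obtain c where "0 \<le> c" "secant d k t - secant d (k + 1) t = c * (real k - t)"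
      using secant_diff[of k d] step by metis
    moreover have "real k - t \<le> 0"
      using step assms by simp
    ultimately have "secant d k t \<le> secant d (Suc k) t"
      by (smt (verit) Suc_eq_plus1 mult_nonneg_nonpos)
    then show ?case
      using step by simp
  qed simp
qed

text \<open>Over the integer \<open>x - d\<close> the highest secant is the one with left endpoint
  there, of index \<open>x - d + 1\<close>, and it touches the graph.\<close>

lemma secant_le:
  assumes "1 \<le> m" "d \<le> x"
  shows "secant d m (real x - real d) \<le> 1 / real (x choose d)"
proof -
  have "secant d m (real (x - d)) \<le> secant d (x - d + 1) (real (x - d))"
    using assms by (intro secant_max) auto
  also have "\<dots> = 1 / real (x choose d)"
    using assms secant_at[of d "x - d"] by simp
  finally show ?thesis
    using assms by (simp add: of_nat_diff)
qed

section \<open>Counting increasing index tuples\<close>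

lemma finite_index_tuples [simp]: "finite (index_tuples n d)"
proof (rule finite_subset)
  show "index_tuples n d \<subseteq> {xs. set xs \<subseteq> {1..n} \<and> length xs = d}"
    by (auto simp: index_tuples_def)
qed (rule finite_lists_length_eq, simp)

lemma index_tuplesD:
  assumes "j \<in> index_tuples n d"
  shows "length j = d" "set j \<subseteq> {1..n}" "finite (set j)" "card (set j) = d"
  using assms by (auto simp: index_tuples_def strict_sorted_iff distinct_card)

text \<open>Forgetting the order maps these tuples bijectively onto the \<open>d\<close>-element
  subsets of \<open>S\<close>; sorting is the inverse. This is the source of C(N, d).\<close>

lemma card_index_tuples_subset:
  assumes "S \<subseteq> {1..n}"
  shows "card {j \<in> index_tuples n d. set j \<subseteq> S} = card S choose d"
proof -
  have fin: "finite S"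
    using assms finite_subset by blast
  have "set ` {j \<in> index_tuples n d. set j \<subseteq> S} = {T. T \<subseteq> S \<and> card T = d}"
  proof (intro equalityI subsetI)
    fix T assume T: "T \<in> {T. T \<subseteq> S \<and> card T = d}"
    with fin have "finite T"
      using finite_subset by blast
    with T assms have "T = set (sorted_list_of_set T)"
      "sorted_list_of_set T \<in> {j \<in> index_tuples n d. set j \<subseteq> S}"
      by (auto simp: index_tuples_def)
    then show "T \<in> set ` {j \<in> index_tuples n d. set j \<subseteq> S}"
      by blast
  qed (use index_tuplesD(4) in blast)
  moreover have "inj_on set {j \<in> index_tuples n d. set j \<subseteq> S}"
    by (rule inj_onI, rule strict_sorted_equal) (simp_all add: index_tuples_def)
  ultimately show ?thesis
    using n_subsets[OF fin, of d] by (simp only: card_image[symmetric])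
qed

section \<open>The bounds for an arbitrary nonnegative weighting of index sets\<close>

text \<open>The random set of occurring indices has finitely many values \<open>S\<close>. All quantities of the theorem
  are linear in the masses \<open>q S\<close> of these values, so that every bound reduces to an inequality
  between functions of \<open>card S\<close>. With \<open>q S\<close> a conditional probability at a fixed sample point,
  the same argument covers the conditional version.\<close>
locale pattern_weights =
  fixes n d :: nat and q :: "nat set \<Rightarrow> real" and s1 s2 :: "nat list \<Rightarrow> real"
  assumes q_nonneg: "S \<subseteq> {1..n} \<Longrightarrow> 0 \<le> q S"
    and s1_eq: "j \<in> index_tuples n d \<Longrightarrow> s1 j = (\<Sum>S | S \<subseteq> {1..n} \<and> set j \<subseteq> S. q S)"
    and s2_eq: "j \<in> index_tuples n d \<Longrightarrow>
      s2 j = (\<Sum>S | S \<subseteq> {1..n} \<and> set j \<subseteq> S. (real (card S) - real d) / (real d + 1) * q S)"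
begin

definition tail :: "nat \<Rightarrow> real" where
  "tail r = (\<Sum>S | S \<subseteq> {1..n} \<and> r \<le> card S. q S)"

definition level :: "nat \<Rightarrow> real" where
  "level r = (\<Sum>S | S \<subseteq> {1..n} \<and> card S = r. q S)"

lemma tail_eq: "tail r = (\<Sum>S\<in>Pow {1..n}. q S * of_bool (r \<le> card S))"
  unfolding tail_def by (intro sum.mono_neutral_cong_left) auto

lemma level_eq: "level r = (\<Sum>S\<in>Pow {1..n}. q S * of_bool (card S = r))"
  unfolding level_def by (intro sum.mono_neutral_cong_left) auto

lemma level_le_tail: "level r \<le> tail r"
  unfolding level_eq tail_eq using q_nonneg by (intro sum_mono mult_left_mono) auto

lemma card_le: "S \<in> Pow {1..n} \<Longrightarrow> card S \<le> n"
  using card_mono[of "{1..n}" S] by simp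

lemma linear_combination:
  assumes "j \<in> index_tuples n d"
  shows "a * s1 j + b * s2 j =
    (\<Sum>S\<in>Pow {1..n}. if set j \<subseteq> S then q S * (a + b * (real (card S) - real d) / (real d + 1)) else 0)"
  unfolding s1_eq[OF assms] s2_eq[OF assms] sum_distrib_left sum.distrib[symmetric]
  by (intro sum.mono_neutral_cong_left) (auto simp: algebra_simps)

text \<open>Interchange of summation. The coefficients may depend on \<open>j\<close> because (iv)
  picks \<open>m\<close> separately for each tuple.\<close>

lemma sum_linear_combination:
  "(\<Sum>j\<in>index_tuples n d. a j * s1 j + b j * s2 j) =
    (\<Sum>S\<in>Pow {1..n}. q S *
      (\<Sum>j | j \<in> index_tuples n d \<and> set j \<subseteq> S. a j + b j * (real (card S) - real d) / (real d + 1)))"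
proof -
  have "(\<Sum>j\<in>index_tuples n d. a j * s1 j + b j * s2 j) = (\<Sum>j\<in>index_tuples n d. \<Sum>S\<in>Pow {1..n}.
      if set j \<subseteq> S then q S * (a j + b j * (real (card S) - real d) / (real d + 1)) else 0)"
    by (intro sum.cong refl linear_combination)
  also have "\<dots> = (\<Sum>S\<in>Pow {1..n}. \<Sum>j\<in>index_tuples n d.
      if set j \<subseteq> S then q S * (a j + b j * (real (card S) - real d) / (real d + 1)) else 0)"
    by (rule sum.swap)
  also have "\<dots> = (\<Sum>S\<in>Pow {1..n}. q S *
      (\<Sum>j | j \<in> index_tuples n d \<and> set j \<subseteq> S. a j + b j * (real (card S) - real d) / (real d + 1)))"
    unfolding sum_distrib_left by (intro sum.cong refl sum.inter_filter[symmetric]) simp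
  finally show ?thesis .
qed

text \<open>For constant coefficients the inner sum just counts C(card S, d) tuples, and the weight
  (card S - d)/(d+1) turns this count into C(card S, d+1).\<close>

lemma sum_linear_combination_const:
  "(\<Sum>j\<in>index_tuples n d. (a * s1 j + b * s2 j) / c) =
    (\<Sum>S\<in>Pow {1..n}. q S *
      ((a * real (card S choose d) + b * real (card S choose (d + 1))) / c))"
proof -
  have "(\<Sum>j | j \<in> index_tuples n d \<and> set j \<subseteq> S. a + b * (real (card S) - real d) / (real d + 1))
      = a * real (card S choose d) + b * real (card S choose (d + 1))" if "S \<in> Pow {1..n}" for S
    using card_index_tuples_subset[of S n d] that
    unfolding real_binomial_Suc_divide by (simp add: distrib_left mult_ac)
  then have "(\<Sum>j\<in>index_tuples n d. a * s1 j + b * s2 j) =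
      (\<Sum>S\<in>Pow {1..n}. q S * (a * real (card S choose d) + b * real (card S choose (d + 1))))"
    unfolding sum_linear_combination by (intro sum.cong) auto
  then show ?thesis
    by (simp add: sum_divide_distrib[symmetric])
qed

lemma sum_linear_difference_const:
  "(\<Sum>j\<in>index_tuples n d. (a * s1 j - b * s2 j) / c) =
    (\<Sum>S\<in>Pow {1..n}. q S *
      ((a * real (card S choose d) - b * real (card S choose (d + 1))) / c))"
  using sum_linear_combination_const[of a "- b" c] by simp

lemma tail_le_s2:
  assumes "d < r"
  shows "tail r \<le> (\<Sum>j\<in>index_tuples n d. s2 j / real (r choose (d + 1)))"
proof -
  have "(\<Sum>j\<in>index_tuples n d. s2 j / real (r choose (d + 1))) =
      (\<Sum>S\<in>Pow {1..n}. q S * (real (card S choose (d + 1)) / real (r choose (d + 1))))"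
    using sum_linear_combination_const[of 0 1 "real (r choose (d + 1))"] by simp
  then show ?thesis
    unfolding tail_eq
    by (simp only:) (intro sum_mono mult_left_mono tail_le_binomial assms q_nonneg PowD)
qed

lemma tail_le:
  assumes "d \<le> r" "r < n"
  shows "tail r \<le> (\<Sum>j\<in>index_tuples n d.
      ((real (n choose (d + 1)) - real (r choose (d + 1))) * s1 j
       - (real (n choose d) - real (r choose d)) * s2 j)
      / (real (n choose (d + 1)) * real (r choose d) - real (n choose d) * real (r choose (d + 1))))"
  unfolding sum_linear_difference_const tail_eq
  by (intro sum_mono mult_left_mono tail_le_chord assms card_le q_nonneg PowD)

lemma level_le:
  assumes "d \<le> r" "r < n"
  shows "level r \<le> (\<Sum>j\<in>index_tuples n d.
      (real (n choose (d + 1)) * s1 j - real (n choose d) * s2 j)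
      / (real (n choose (d + 1)) * real (r choose d) - real (n choose d) * real (r choose (d + 1))))"
  unfolding sum_linear_difference_const level_eq
  by (intro sum_mono mult_left_mono level_le_chord assms card_le q_nonneg PowD)

lemma tail_ge:
  assumes "d < r" "r \<le> n"
  shows "(\<Sum>j\<in>index_tuples n d.
      (- real ((r - 1) choose (d + 1)) * s1 j + real ((r - 1) choose d) * s2 j)
      / (real (n choose (d + 1)) * real ((r - 1) choose d) - real (n choose d) * real ((r - 1) choose (d + 1))))
    \<le> tail r"
  unfolding sum_linear_combination_const tail_eq
  by (intro sum_mono mult_left_mono chord_le_tail assms card_le q_nonneg PowD)

text \<open>Makes the bound for p_n in (iii) the case \<open>r = n\<close> of
  \<open>tail_ge\<close>.\<close>

lemma tail_n: "tail n = level n"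
proof -
  have "n \<le> card S \<longleftrightarrow> card S = n" if "S \<in> Pow {1..n}" for S
    using card_le[OF that] by auto
  then show ?thesis
    unfolding tail_eq level_eq by (intro sum.cong) simp_all
qed

lemma level_d_ge:
  assumes "1 \<le> d"
  shows "(\<Sum>j\<in>index_tuples n d. s1 j - real (d + 1) * s2 j) \<le> level d"
proof -
  have "(\<Sum>j\<in>index_tuples n d. s1 j - real (d + 1) * s2 j) = (\<Sum>S\<in>Pow {1..n}. q S *
      (real (card S choose d) - real (d + 1) * real (card S choose (d + 1))))"
    using sum_linear_difference_const[of 1 "real (d + 1)" 1] by (simp only: mult_1 div_by_1)
  also have "\<dots> \<le> level d"
    unfolding level_eq
    by (intro sum_mono mult_left_mono binomial_diff_le_level assms q_nonneg PowD)
  finally show ?thesis .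
qed

text \<open>Each tuple inside \<open>S\<close> contributes a secant value at
  \<open>card S - d\<close>, hence at most 1/C(card S, d) whatever \<open>m j\<close> is. There are
  C(card S, d) such tuples, so \<open>S\<close> receives a total weight of at most 1.\<close>

lemma tail_d_ge:
  assumes "\<And>j. j \<in> index_tuples n d \<Longrightarrow> 1 \<le> m j"
  shows "(\<Sum>j\<in>index_tuples n d. real (d + 1) * (real (m j) * s1 j - real d * s2 j)
      / (real (m j + d) * real ((m j + d - 1) choose d))) \<le> tail d"
proof -
  define c where "c j = real (m j + d) * real ((m j + d - 1) choose d)" for j
  define a where "a j = real (d + 1) * real (m j) / c j" for j
  \<comment> \<open>The factor d+1 cancels against the denominator in the weight of
    \<open>s2\<close>, leaving the secant slope -d/c.\<close>
  define b where "b j = - ((real d + 1) * (real d / c j))" for j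
  have "real (d + 1) * (real (m j) * s1 j - real d * s2 j) / c j = a j * s1 j + b j * s2 j" for j
    unfolding a_def b_def by (simp add: diff_divide_distrib right_diff_distrib mult.assoc)
  then have "(\<Sum>j\<in>index_tuples n d. real (d + 1) * (real (m j) * s1 j - real d * s2 j) / c j)
      = (\<Sum>S\<in>Pow {1..n}. q S *
        (\<Sum>j | j \<in> index_tuples n d \<and> set j \<subseteq> S. a j + b j * (real (card S) - real d) / (real d + 1)))"
    by (simp add: sum_linear_combination)
  also have "\<dots> \<le> (\<Sum>S\<in>Pow {1..n}. q S * of_bool (d \<le> card S))"
  proof (intro sum_mono mult_left_mono)
    fix S assume S: "S \<in> Pow {1..n}"
    show "(\<Sum>j | j \<in> index_tuples n d \<and> set j \<subseteq> S. a j + b j * (real (card S) - real d) / (real d + 1))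
        \<le> of_bool (d \<le> card S)"
    proof (cases "d \<le> card S")
      case True
      have "(\<Sum>j | j \<in> index_tuples n d \<and> set j \<subseteq> S. a j + b j * (real (card S) - real d) / (real d + 1))
          \<le> (\<Sum>j | j \<in> index_tuples n d \<and> set j \<subseteq> S. 1 / real (card S choose d))"
      proof (rule sum_mono)
        fix j assume "j \<in> {j. j \<in> index_tuples n d \<and> set j \<subseteq> S}"
        then have m: "1 \<le> m j" using assms by auto
        have "b j * (real (card S) - real d) / (real d + 1) = - real d * (real (card S) - real d) / c j"
          using less_imp_neq[OF add_nonneg_pos[of "real d" 1]] by (simp add: b_def)
        then have "a j + b j * (real (card S) - real d) / (real d + 1) = secant d (m j) (real (card S) - real d)"
          unfolding secant_def a_def c_def by (simp add: diff_divide_distrib)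
        with secant_le[OF m True]
        show "a j + b j * (real (card S) - real d) / (real d + 1) \<le> 1 / real (card S choose d)"
          by simp
      qed
      also have "\<dots> \<le> 1"
        using card_index_tuples_subset[of S n d] S True by simp
      finally show ?thesis
        using True by simp
    next
      case False
      then have "{j \<in> index_tuples n d. set j \<subseteq> S} = {}"
        using card_index_tuples_subset[of S n d] S by (simp add: binomial_eq_0)
      with False show ?thesis
        by (simp only: sum.empty) simp
    qed
  qed (use q_nonneg in auto)
  also have "\<dots> = tail d"
    unfolding tail_eq ..
  finally show ?thesis
    unfolding c_def .
qed

lemma s1_nonneg: "j \<in> index_tuples n d \<Longrightarrow> 0 \<le> s1 j"
  using q_nonneg by (auto simp: s1_eq intro!: sum_nonneg)

text \<open>In (d+1) s2 each \<open>q S\<close> is weighted by \<open>card S - d\<close>, which lies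
  between 0 and n-d. This puts the ratio (d+1) s2/s1 in the range of the admissible
  \<open>m\<close>.\<close>

lemma s2_bounds:
  assumes "j \<in> index_tuples n d"
  shows "0 \<le> real (d + 1) * s2 j" "real (d + 1) * s2 j \<le> (real n - real d) * s1 j"
proof -
  have *: "real (d + 1) * s2 j = (\<Sum>S | S \<subseteq> {1..n} \<and> set j \<subseteq> S. (real (card S) - real d) * q S)"
    unfolding s2_eq[OF assms] sum_distrib_left
    using less_imp_neq[OF add_nonneg_pos[of "real d" 1]] by (intro sum.cong) (simp_all add: add.commute)
  have card: "d \<le> card S" if "S \<subseteq> {1..n}" "set j \<subseteq> S" for S
    using index_tuplesD(4)[OF assms] that by (metis card_mono finite_atLeastAtMost finite_subset)
  show "0 \<le> real (d + 1) * s2 j"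
    unfolding * using q_nonneg card by (intro sum_nonneg mult_nonneg_nonneg) auto
  show "real (d + 1) * s2 j \<le> (real n - real d) * s1 j"
    unfolding * s1_eq[OF assms] sum_distrib_left using q_nonneg card_le by (intro sum_mono mult_right_mono) auto
qed

lemma optimal_exists:
  assumes "j \<in> index_tuples n d" "d < n" "0 < s1 j"
  shows "\<exists>m\<in>{1..n - d}. real m - 1 \<le> real (d + 1) * s2 j / s1 j \<and> real (d + 1) * s2 j / s1 j \<le> real m"
proof -
  define y where "y = real (d + 1) * s2 j / s1 j"
  have y: "0 \<le> y" "y \<le> real (n - d)"
    using s2_bounds[OF assms(1)] assms(2,3) by (simp_all add: y_def divide_le_eq of_nat_diff)
  show ?thesis
  \<comment> \<open>The ceiling of \<open>y\<close> is the natural choice, but for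
    \<open>y = 0\<close> it would be 0, which is not admissible; there \<open>m = 1\<close>
    satisfies both inequalities.\<close>
  proof (cases "y = 0")
    case True
    then show ?thesis
      using assms(2) by (intro bexI[of _ 1]) (auto simp: y_def)
  next
    case False
    have "nat \<lceil>y\<rceil> \<in> {1..n - d}"
      using y False by (simp add: Suc_le_eq nat_le_iff ceiling_le_iff)
    moreover have "real (nat \<lceil>y\<rceil>) - 1 \<le> y" "y \<le> real (nat \<lceil>y\<rceil>)"
      using y by linarith+
    ultimately show ?thesis
      unfolding y_def by blast
  qed
qed

text \<open>Pulling out \<open>s1 j\<close> turns the summand into
  \<open>s1 j * secant d m y\<close>, where \<open>y\<close> is the ratio in the hypotheses, so
  \<open>secant_max\<close> decides.\<close>

lemma optimal_is_max:
  assumes "j \<in> index_tuples n d" "0 < s1 j" "m \<in> {1..n - d}"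
    "real m - 1 \<le> real (d + 1) * s2 j / s1 j" "real (d + 1) * s2 j / s1 j \<le> real m"
  shows "is_arg_max (\<lambda>m. real (d + 1) * (real m * s1 j - real d * s2 j)
      / (real (m + d) * real ((m + d - 1) choose d))) (\<lambda>m. m \<in> {1..n - d}) m"
proof -
  define y where "y = real (d + 1) * s2 j / s1 j"
  have y: "s1 j * y = real (d + 1) * s2 j"
    using assms(2) by (simp add: y_def)
  have "real (d + 1) * (real k * s1 j - real d * s2 j) = real (d + 1) * real k * s1 j - real d * (s1 j * y)" for k
    unfolding y by (simp add: algebra_simps)
  then have "real (d + 1) * (real k * s1 j - real d * s2 j) = s1 j * (real (d + 1) * real k - real d * y)" for k
    by (simp add: algebra_simps)
  then have *: "real (d + 1) * (real k * s1 j - real d * s2 j) / (real (k + d) * real ((k + d - 1) choose d))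
      = s1 j * secant d k y" for k
    unfolding secant_def by simp
  have "s1 j * secant d k y \<le> s1 j * secant d m y" if "k \<in> {1..n - d}" for k
    using assms that by (intro mult_left_mono secant_max) (auto simp: y_def)
  with assms(3) show ?thesis
    unfolding is_arg_max_def * by (auto simp: not_less)
qed

text \<open>Here \<open>s1 j = 0\<close>, which forces \<open>s2 j = 0\<close> by
  \<open>s2_bounds\<close>; the objective vanishes identically and every admissible \<open>m\<close>
  is maximal.\<close>

lemma null_is_max:
  assumes "j \<in> index_tuples n d" "\<not> 0 < s1 j" "m \<in> {1..n - d}"
  shows "is_arg_max (\<lambda>m. real (d + 1) * (real m * s1 j - real d * s2 j)
      / (real (m + d) * real ((m + d - 1) choose d))) (\<lambda>m. m \<in> {1..n - d}) m"
proof -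
  have "s1 j = 0"
    using s1_nonneg[OF assms(1)] assms(2) by simp
  moreover from this have "s2 j = 0"
    using s2_bounds[OF assms(1)] by (simp add: zero_le_mult_iff mult_le_0_iff)
  ultimately show ?thesis
    using assms(3) by (simp add: is_arg_max_def)
qed

end

section \<open>Events determined by the set of occurring indices\<close>

text \<open>A common form for all events of the theorem: each is a finite disjoint union of atoms
  \<open>pattern_event M A n {S}\<close>, whose masses serve as the weights
  \<open>q S\<close>.\<close>

definition pattern_event :: "'a measure \<Rightarrow> (nat \<Rightarrow> 'a set) \<Rightarrow> nat \<Rightarrow> nat set set \<Rightarrow> 'a set" where
  "pattern_event M A n Q = {\<omega> \<in> space M. {l \<in> {1..n}. \<omega> \<in> A l} \<in> Q}"

lemma exactly_event_eq: "exactly_event M A n i = pattern_event M A n {S. S \<subseteq> {1..n} \<and> card S = i}"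
  by (auto simp: exactly_event_def pattern_event_def)

lemma at_least_event_eq: "at_least_event M A n r = pattern_event M A n {S. S \<subseteq> {1..n} \<and> r \<le> card S}"
proof -
  have "card {l \<in> {1..n}. \<omega> \<in> A l} \<le> n" for \<omega>
    by (rule order_trans[OF card_mono[of "{1..n}"]]) auto
  then show ?thesis
    by (auto simp: at_least_event_def exactly_event_def pattern_event_def)
qed

lemma meet_event_eq:
  assumes "set j \<subseteq> {1..n}"
  shows "meet_event M A j = pattern_event M A n {S. S \<subseteq> {1..n} \<and> set j \<subseteq> S}"
  using assms by (auto simp: meet_event_def pattern_event_def)

lemma pattern_event_Int: "pattern_event M A n Q \<inter> pattern_event M A n R = pattern_event M A n (Q \<inter> R)"
  by (auto simp: pattern_event_def)

lemma indicator_pattern_event: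
  assumes "Q \<subseteq> Pow {1..n}" "\<omega> \<in> space M"
  shows "indicator (pattern_event M A n Q) \<omega> = (\<Sum>S\<in>Q. indicator (pattern_event M A n {S}) \<omega> :: real)"
proof -
  have "finite Q"
    using assms(1) finite_subset by blast
  then show ?thesis
    using assms(2) by (simp add: pattern_event_def indicator_def of_bool_def)
qed

lemma sets_pattern_event:
  assumes "\<And>l. l \<in> {1..n} \<Longrightarrow> A l \<in> sets M" "Q \<subseteq> Pow {1..n}"
  shows "pattern_event M A n Q \<in> sets M"
proof -
  have atom: "pattern_event M A n {S} \<in> sets M" if "S \<subseteq> {1..n}" for S
  proof -
    have "pattern_event M A n {S} = {\<omega> \<in> space M. \<forall>l\<in>{1..n}. \<omega> \<in> A l \<longleftrightarrow> l \<in> S}"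
      using that by (auto simp: pattern_event_def)
    also have "\<dots> \<in> sets M"
    proof (rule sets.sets_Collect_finite_All)
      fix l assume "l \<in> {1..n}"
      then have [measurable]: "A l \<in> sets M" by (rule assms(1))
      show "{\<omega> \<in> space M. \<omega> \<in> A l \<longleftrightarrow> l \<in> S} \<in> sets M"
        by measurable
    qed simp
    finally show ?thesis .
  qed
  have "finite Q"
    using assms(2) finite_subset by blast
  moreover have "pattern_event M A n {S} \<in> sets M" if "S \<in> Q" for S
    using assms(2) that by (intro atom) blast
  ultimately have "(\<Union>S\<in>Q. pattern_event M A n {S}) \<in> sets M"
    by (rule sets.finite_UN)
  also have "(\<Union>S\<in>Q. pattern_event M A n {S}) = pattern_event M A n Q"
    by (auto simp: pattern_event_def)
  finally show ?thesis .
qed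

lemma (in finite_measure) measure_pattern_event:
  assumes "\<And>l. l \<in> {1..n} \<Longrightarrow> A l \<in> sets M" "Q \<subseteq> Pow {1..n}"
  shows "measure M (pattern_event M A n Q) = (\<Sum>S\<in>Q. measure M (pattern_event M A n {S}))"
proof -
  have "finite Q"
    using assms(2) finite_subset by blast
  moreover have "pattern_event M A n Q = (\<Union>S\<in>Q. pattern_event M A n {S})"
    by (auto simp: pattern_event_def)
  moreover have "(\<lambda>S. pattern_event M A n {S}) ` Q \<subseteq> sets M"
    using assms by (intro image_subsetI sets_pattern_event) blast+
  moreover have "disjoint_family_on (\<lambda>S. pattern_event M A n {S}) Q"
    by (auto simp: disjoint_family_on_def pattern_event_def)
  ultimately show ?thesis
    by (simp only: finite_measure_finite_Union)
qed

text \<open>Conditional probabilities are nonnegative and additive only off a null set that depends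
  on the event. There are finitely many families \<open>Q\<close>, so one null set serves for all of
  them.\<close>

lemma (in prob_space) AE_cprob_pattern_event:
  assumes "\<And>l. l \<in> {1..n} \<Longrightarrow> A l \<in> sets M" "subalgebra M F"
  shows "AE \<omega> in M. \<forall>Q\<in>Pow (Pow {1..n}).
    0 \<le> cprob M F (pattern_event M A n Q) \<omega> \<and>
    cprob M F (pattern_event M A n Q) \<omega> = (\<Sum>S\<in>Q. cprob M F (pattern_event M A n {S}) \<omega>)"
proof (rule AE_finite_allI)
  fix Q assume "Q \<in> Pow (Pow {1..n})"
  then have Q: "Q \<subseteq> Pow {1..n}" by simp
  interpret sigma_finite_subalgebra M F
    using assms(2) finite_measure_axioms
    by (intro finite_measure_subalgebra_is_sigma_finite)
      (simp add: finite_measure_subalgebra_def finite_measure_subalgebra_axioms_def)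
  \<comment> \<open>Intersecting with \<open>Pow {1..n}\<close> makes \<open>f S\<close> zero for
    irrelevant \<open>S\<close>, so that it is integrable for every \<open>S\<close>, as the
    linearity step below uses.\<close>
  define f where "f S = (indicator (pattern_event M A n ({S} \<inter> Pow {1..n})) :: 'a \<Rightarrow> real)" for S
  have [measurable]: "pattern_event M A n Q \<in> sets M"
    using assms(1) Q by (rule sets_pattern_event)
  have f: "integrable M (f S)" for S
    unfolding f_def using assms(1) by (intro integrable_real_indicator sets_pattern_event) (auto simp: emeasure_eq_measure)
  then have [measurable]: "f S \<in> borel_measurable M" for S
    by blast
  have f_eq: "f S = indicator (pattern_event M A n {S})" if "S \<in> Q" for S
  proof -
    have "{S} \<inter> Pow {1..n} = {S}"
      using that Q by auto
    then show ?thesis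
      by (simp only: f_def)
  qed
  have "AE \<omega> in M. indicator (pattern_event M A n Q) \<omega> = (\<Sum>S\<in>Q. f S \<omega>)"
    by (intro AE_I2) (simp add: indicator_pattern_event[OF Q] f_eq)
  then have "AE \<omega> in M. cprob M F (pattern_event M A n Q) \<omega> = real_cond_exp M F (\<lambda>\<omega>. \<Sum>S\<in>Q. f S \<omega>) \<omega>"
    unfolding cprob_def by (rule real_cond_exp_cong) simp_all
  moreover have "AE \<omega> in M. real_cond_exp M F (\<lambda>\<omega>. \<Sum>S\<in>Q. f S \<omega>) \<omega> = (\<Sum>S\<in>Q. real_cond_exp M F (f S) \<omega>)"
    using f by simp
  moreover have "AE \<omega> in M. 0 \<le> cprob M F (pattern_event M A n Q) \<omega>"
    unfolding cprob_def by (rule real_cond_exp_pos) auto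
  ultimately show "AE \<omega> in M. 0 \<le> cprob M F (pattern_event M A n Q) \<omega> \<and>
    cprob M F (pattern_event M A n Q) \<omega> = (\<Sum>S\<in>Q. cprob M F (pattern_event M A n {S}) \<omega>)"
    by eventually_elim (simp add: cprob_def f_eq)
qed simp

section \<open>Probabilities and conditional probabilities as weights\<close>

lemma sum_by_card:
  fixes q :: "nat set \<Rightarrow> real"
  assumes "d \<le> n" "\<And>S. S \<in> T \<Longrightarrow> S \<subseteq> {1..n} \<and> d \<le> card S"
  shows "(\<Sum>i = 1..n - d + 1. w (i + d - 1) * (\<Sum>S | S \<in> T \<and> card S = i + d - 1. q S))
    = (\<Sum>S\<in>T. w (card S) * q S)"
proof -
  have fin: "finite T"
    by (rule finite_subset[of T "Pow {1..n}"]) (use assms(2) in blast, simp)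
  have le: "card S \<le> n" if "S \<in> T" for S
    using assms(2)[OF that] card_mono[of "{1..n}" S] by simp
  have "card ` T \<subseteq> {d..n}"
  proof
    fix i assume "i \<in> card ` T"
    then obtain S where "S \<in> T" "i = card S" by blast
    then show "i \<in> {d..n}"
      using assms(2)[of S] le[of S] by simp
  qed
  then have "(\<Sum>S\<in>T. w (card S) * q S) = (\<Sum>i\<in>{d..n}. \<Sum>S | S \<in> T \<and> card S = i. w (card S) * q S)"
    using fin by (intro sum.group[symmetric]) simp_all
  also have "\<dots> = (\<Sum>i\<in>{d..n}. w i * (\<Sum>S | S \<in> T \<and> card S = i. q S))"
    unfolding sum_distrib_left by (intro sum.cong) auto
  also have "\<dots> = (\<Sum>i = 1..n - d + 1. w (i + d - 1) * (\<Sum>S | S \<in> T \<and> card S = i + d - 1. q S))"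
    \<comment> \<open>The shifted index \<open>i + d - 1\<close> runs through \<open>d..n\<close>;
      as \<open>i \<ge> 1\<close>, nothing is truncated even for \<open>d = 0\<close>.\<close>
    using assms(1) by (intro sum.reindex_bij_witness[of _ "\<lambda>i. i + d - 1" "\<lambda>i. i + 1 - d"]) auto
  finally show ?thesis ..
qed

text \<open>Undoing the grouping by cardinality gives \<open>S\<close> the weight C(card S,
  k+d-1)/C(card S, d), which is 1 for k = 1 and (card S - d)/(d+1) for k = 2.\<close>

lemma (in prob_space) pattern_weights_measure:
  assumes "\<And>l. l \<in> {1..n} \<Longrightarrow> A l \<in> sets M" "d \<le> n"
  shows "pattern_weights n d (\<lambda>S. measure M (pattern_event M A n {S})) (s_num M A n 1) (s_num M A n 2)"
proof
  let ?q = "\<lambda>S. measure M (pattern_event M A n {S})"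
  fix j assume j: "j \<in> index_tuples n d"
  note j' = index_tuplesD[OF j]
  define T where "T = {S. S \<subseteq> {1..n} \<and> set j \<subseteq> S}"
  have T: "S \<subseteq> {1..n} \<and> d \<le> card S" if "S \<in> T" for S
    using that j'(4) unfolding T_def by (metis card_mono finite_atLeastAtMost finite_subset mem_Collect_eq)
  have "measure M (exactly_event M A n i \<inter> meet_event M A j) = (\<Sum>S | S \<in> T \<and> card S = i. ?q S)" for i
    unfolding exactly_event_eq meet_event_eq[OF j'(2)] pattern_event_Int
    by (subst measure_pattern_event[OF assms(1)]) (auto simp: T_def intro!: sum.cong)
  then have "s_num M A n k j = (\<Sum>i = 1..n - d + 1. real ((i + d - 1) choose (k + d - 1)) / real ((i + d - 1) choose d)
      * (\<Sum>S | S \<in> T \<and> card S = i + d - 1. ?q S))" for k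
    unfolding s_num_def j'(1) Let_def by (simp only: times_divide_eq_left times_divide_eq_right)
  then have s: "s_num M A n k j =
      (\<Sum>S\<in>T. real (card S choose (k + d - 1)) / real (card S choose d) * ?q S)" for k
    using sum_by_card[OF assms(2) T,
        where w = "\<lambda>i. real (i choose (k + d - 1)) / real (i choose d)" and q = ?q]
    by (simp only:)
  have pos: "0 < real (card S choose d)" if "S \<in> T" for S
    using T[OF that] by simp
  show "s_num M A n 1 j = (\<Sum>S | S \<subseteq> {1..n} \<and> set j \<subseteq> S. ?q S)"
    unfolding s T_def[symmetric]
  proof (rule sum.cong)
    fix S assume "S \<in> T"
    with pos[of S] show "real (card S choose (1 + d - 1)) / real (card S choose d) * ?q S = ?q S"
      by simp
  qed simp
  show "s_num M A n 2 j = (\<Sum>S | S \<subseteq> {1..n} \<and> set j \<subseteq> S. (real (card S) - real d) / (real d + 1) * ?q S)"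
    unfolding s T_def[symmetric]
  proof (rule sum.cong)
    fix S assume "S \<in> T"
    have d: "2 + d - 1 = d + 1"
      by simp
    show "real (card S choose (2 + d - 1)) / real (card S choose d) * ?q S
        = (real (card S) - real d) / (real d + 1) * ?q S"
      using pos[OF \<open>S \<in> T\<close>] unfolding d real_binomial_Suc_divide by simp
  qed simp
qed simp

text \<open>Double counting: for k = 2 a set \<open>S\<close> containing \<open>j\<close> is met
  once for each additional index in \<open>S - set j\<close>, hence \<open>card S - d\<close> times,
  and the prefactor d!/(d+1)! supplies 1/(d+1).\<close>

lemma pattern_weights_cprob:
  assumes "\<And>Q. Q \<subseteq> Pow {1..n} \<Longrightarrow> 0 \<le> cprob M F (pattern_event M A n Q) \<omega>"
    "\<And>Q. Q \<subseteq> Pow {1..n} \<Longrightarrow>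
      cprob M F (pattern_event M A n Q) \<omega> = (\<Sum>S\<in>Q. cprob M F (pattern_event M A n {S}) \<omega>)"
  shows "pattern_weights n d (\<lambda>S. cprob M F (pattern_event M A n {S}) \<omega>)
    (\<lambda>j. s_cond M F A n 1 j \<omega>) (\<lambda>j. s_cond M F A n 2 j \<omega>)"
proof
  let ?q = "\<lambda>S. cprob M F (pattern_event M A n {S}) \<omega>"
  show "0 \<le> ?q S" if "S \<subseteq> {1..n}" for S
    using that by (intro assms(1)) auto
  fix j assume j: "j \<in> index_tuples n d"
  note j' = index_tuplesD[OF j]
  have meet: "cprob M F (meet_event M A u) \<omega> = (\<Sum>S | S \<subseteq> {1..n} \<and> set u \<subseteq> S. ?q S)"
    if "set u \<subseteq> {1..n}" for u
    unfolding meet_event_eq[OF that] by (rule assms(2)) auto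
  show "s_cond M F A n 1 j \<omega> = (\<Sum>S | S \<subseteq> {1..n} \<and> set j \<subseteq> S. ?q S)"
  proof -
    \<comment> \<open>For k = 1 only the empty tuple remains, and the prefactor is 1.\<close>
    have "{u. length u = 0 \<and> distinct u \<and> set u \<subseteq> {1..n} - set j} = {[]}"
      by auto
    then show ?thesis
      by (simp add: s_cond_def j'(1) Let_def meet[OF j'(2)] del: length_0_conv)
  qed
  show "s_cond M F A n 2 j \<omega> =
    (\<Sum>S | S \<subseteq> {1..n} \<and> set j \<subseteq> S. (real (card S) - real d) / (real d + 1) * ?q S)"
  proof -
    define T where "T = {S. S \<subseteq> {1..n} \<and> set j \<subseteq> S}"
    have fin: "finite T"
      by (rule finite_subset[of _ "Pow {1..n}"]) (auto simp: T_def)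
    have "{u. length u = 2 - 1 \<and> distinct u \<and> set u \<subseteq> {1..n} - set j} = (\<lambda>l. [l]) ` ({1..n} - set j)"
      by (auto simp: length_Suc_conv)
    then have "(\<Sum>u | length u = 2 - 1 \<and> distinct u \<and> set u \<subseteq> {1..n} - set j. cprob M F (meet_event M A (u @ j)) \<omega>)
        = (\<Sum>l\<in>{1..n} - set j. cprob M F (meet_event M A (l # j)) \<omega>)"
      by (simp add: sum.reindex inj_on_def)
    also have "\<dots> = (\<Sum>l\<in>{1..n} - set j. \<Sum>S\<in>T. if l \<in> S then ?q S else 0)"
    proof (intro sum.cong refl)
      fix l assume "l \<in> {1..n} - set j"
      then have "set (l # j) \<subseteq> {1..n}"
        using j'(2) by auto
      then have "cprob M F (meet_event M A (l # j)) \<omega> = (\<Sum>S | S \<subseteq> {1..n} \<and> set (l # j) \<subseteq> S. ?q S)"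
        by (rule meet)
      also have "{S. S \<subseteq> {1..n} \<and> set (l # j) \<subseteq> S} = {S \<in> T. l \<in> S}"
        by (auto simp: T_def)
      finally show "cprob M F (meet_event M A (l # j)) \<omega> = (\<Sum>S\<in>T. if l \<in> S then ?q S else 0)"
        by (simp only: sum.inter_filter[OF fin])
    qed
    also have "\<dots> = (\<Sum>S\<in>T. \<Sum>l\<in>{1..n} - set j. if l \<in> S then ?q S else 0)"
      by (rule sum.swap)
    also have "\<dots> = (\<Sum>S\<in>T. (real (card S) - real d) * ?q S)"
    proof (intro sum.cong refl)
      fix S assume S: "S \<in> T"
      then have "{l \<in> {1..n} - set j. l \<in> S} = S - set j"
        by (auto simp: T_def)
      moreover have "card (S - set j) = card S - d" "d \<le> card S"
        using S j' by (auto simp: T_def card_Diff_subset) (metis card_mono finite_atLeastAtMost finite_subset)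
      ultimately show "(\<Sum>l\<in>{1..n} - set j. if l \<in> S then ?q S else 0) = (real (card S) - real d) * ?q S"
        using sum.inter_filter[of "{1..n} - set j" "\<lambda>_. ?q S" "\<lambda>l. l \<in> S"] by (simp add: of_nat_diff)
    qed
    finally have "s_cond M F A n 2 j \<omega> = fact d / fact (d + 1) * (\<Sum>S\<in>T. (real (card S) - real d) * ?q S)"
      by (simp add: s_cond_def j'(1) Let_def)
    also have "fact (d + 1) = (real d + 1) * fact d"
      by (simp add: add.commute)
    also have "fact d / ((real d + 1) * fact d) = 1 / (real d + 1)"
      by (rule nonzero_divide_mult_cancel_right) simp
    finally show ?thesis
      unfolding T_def by (simp add: sum_distrib_left)
  qed
qed

section \<open>The bounds for probabilities and their conditional versions\<close>

theorem theorem2: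
  fixes M :: "'a measure" and A :: "nat \<Rightarrow> 'a set" and n r d :: nat
  assumes "prob_space M"
    and "\<And>l. l \<in> {1..n} \<Longrightarrow> A l \<in> sets M"
    and "1 \<le> r" and "r \<le> n" and "d \<le> r"
  shows
    "(r - d \<ge> 1 \<longrightarrow>
       measure M (at_least_event M A n r) \<le> (\<Sum>j\<in>index_tuples n d. s_num M A n 2 j / real (r choose (d + 1))) \<and>
       measure M (exactly_event M A n r) \<le> (\<Sum>j\<in>index_tuples n d. s_num M A n 2 j / real (r choose (d + 1)))) \<and>
     (n - r \<ge> 1 \<longrightarrow>
       measure M (at_least_event M A n r) \<le> (\<Sum>j\<in>index_tuples n d.
         ((real (n choose (d + 1)) - real (r choose (d + 1))) * s_num M A n 1 j
          - (real (n choose d) - real (r choose d)) * s_num M A n 2 j)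
         / (real (n choose (d + 1)) * real (r choose d) - real (n choose d) * real (r choose (d + 1)))) \<and>
       measure M (exactly_event M A n r) \<le> (\<Sum>j\<in>index_tuples n d.
         (real (n choose (d + 1)) * s_num M A n 1 j - real (n choose d) * s_num M A n 2 j)
         / (real (n choose (d + 1)) * real (r choose d) - real (n choose d) * real (r choose (d + 1))))) \<and>
     (r - d \<ge> 1 \<longrightarrow>
       measure M (at_least_event M A n r) \<ge> (\<Sum>j\<in>index_tuples n d.
         (- real ((r - 1) choose (d + 1)) * s_num M A n 1 j + real ((r - 1) choose d) * s_num M A n 2 j)
         / (real (n choose (d + 1)) * real ((r - 1) choose d) - real (n choose d) * real ((r - 1) choose (d + 1)))) \<and>
       measure M (exactly_event M A n n) \<ge> (\<Sum>j\<in>index_tuples n d.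
         (- real ((n - 1) choose (d + 1)) * s_num M A n 1 j + real ((n - 1) choose d) * s_num M A n 2 j)
         / (real (n choose (d + 1)) * real ((n - 1) choose d) - real (n choose d) * real ((n - 1) choose (d + 1))))) \<and>
     (r = d \<and> d \<ge> 1 \<and> n - r \<ge> 1 \<longrightarrow>
       (\<forall>m :: nat list \<Rightarrow> nat. (\<forall>j\<in>index_tuples n d. 1 \<le> m j \<and> m j \<le> n - d) \<longrightarrow>
          measure M (at_least_event M A n d) \<ge> (\<Sum>j\<in>index_tuples n d.
            real (d + 1) * (real (m j) * s_num M A n 1 j - real d * s_num M A n 2 j)
            / (real (m j + d) * real ((m j + d - 1) choose d)))) \<and>
       measure M (exactly_event M A n d) \<ge> (\<Sum>j\<in>index_tuples n d. (s_num M A n 1 j - real (d + 1) * s_num M A n 2 j)) \<and>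
       (\<forall>j\<in>index_tuples n d.
          (s_num M A n 1 j > 0 \<longrightarrow>
             (\<exists>m\<in>{1..n - d}. real m - 1 \<le> real (d + 1) * s_num M A n 2 j / s_num M A n 1 j \<and>
                              real (d + 1) * s_num M A n 2 j / s_num M A n 1 j \<le> real m) \<and>
             (\<forall>m\<in>{1..n - d}. real m - 1 \<le> real (d + 1) * s_num M A n 2 j / s_num M A n 1 j \<and>
                              real (d + 1) * s_num M A n 2 j / s_num M A n 1 j \<le> real m \<longrightarrow>
                is_arg_max
                        (\<lambda>m. real (d + 1) * (real m * s_num M A n 1 j - real d * s_num M A n 2 j)
                              / (real (m + d) * real ((m + d - 1) choose d)))
                        (\<lambda>m. m \<in> {1..n - d}) m)) \<and>
          (\<not> s_num M A n 1 j > 0 \<longrightarrow> (\<forall>m\<in>{1, n - d}.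
                is_arg_max
                        (\<lambda>m. real (d + 1) * (real m * s_num M A n 1 j - real d * s_num M A n 2 j)
                              / (real (m + d) * real ((m + d - 1) choose d)))
                        (\<lambda>m. m \<in> {1..n - d}) m)))) \<and>
     (\<forall>F. subalgebra M F \<longrightarrow> (AE \<omega> in M.
        (r - d \<ge> 1 \<longrightarrow>
          cprob M F (at_least_event M A n r) \<omega> \<le> (\<Sum>j\<in>index_tuples n d. s_cond M F A n 2 j \<omega> / real (r choose (d + 1))) \<and>
          cprob M F (exactly_event M A n r) \<omega> \<le> (\<Sum>j\<in>index_tuples n d. s_cond M F A n 2 j \<omega> / real (r choose (d + 1)))) \<and>
        (n - r \<ge> 1 \<longrightarrow>
          cprob M F (at_least_event M A n r) \<omega> \<le> (\<Sum>j\<in>index_tuples n d.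
            ((real (n choose (d + 1)) - real (r choose (d + 1))) * s_cond M F A n 1 j \<omega>
             - (real (n choose d) - real (r choose d)) * s_cond M F A n 2 j \<omega>)
            / (real (n choose (d + 1)) * real (r choose d) - real (n choose d) * real (r choose (d + 1)))) \<and>
          cprob M F (exactly_event M A n r) \<omega> \<le> (\<Sum>j\<in>index_tuples n d.
            (real (n choose (d + 1)) * s_cond M F A n 1 j \<omega> - real (n choose d) * s_cond M F A n 2 j \<omega>)
            / (real (n choose (d + 1)) * real (r choose d) - real (n choose d) * real (r choose (d + 1))))) \<and>
        (r - d \<ge> 1 \<longrightarrow>
          cprob M F (at_least_event M A n r) \<omega> \<ge> (\<Sum>j\<in>index_tuples n d.
            (- real ((r - 1) choose (d + 1)) * s_cond M F A n 1 j \<omega> + real ((r - 1) choose d) * s_cond M F A n 2 j \<omega>)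
            / (real (n choose (d + 1)) * real ((r - 1) choose d) - real (n choose d) * real ((r - 1) choose (d + 1)))) \<and>
          cprob M F (exactly_event M A n n) \<omega> \<ge> (\<Sum>j\<in>index_tuples n d.
            (- real ((n - 1) choose (d + 1)) * s_cond M F A n 1 j \<omega> + real ((n - 1) choose d) * s_cond M F A n 2 j \<omega>)
            / (real (n choose (d + 1)) * real ((n - 1) choose d) - real (n choose d) * real ((n - 1) choose (d + 1))))) \<and>
        (r = d \<and> d \<ge> 1 \<and> n - r \<ge> 1 \<longrightarrow>
          (\<forall>m :: nat list \<Rightarrow> nat. (\<forall>j\<in>index_tuples n d. 1 \<le> m j \<and> m j \<le> n - d) \<longrightarrow>
             cprob M F (at_least_event M A n d) \<omega> \<ge> (\<Sum>j\<in>index_tuples n d.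
               real (d + 1) * (real (m j) * s_cond M F A n 1 j \<omega> - real d * s_cond M F A n 2 j \<omega>)
               / (real (m j + d) * real ((m j + d - 1) choose d)))) \<and>
          cprob M F (exactly_event M A n d) \<omega> \<ge> (\<Sum>j\<in>index_tuples n d. (s_cond M F A n 1 j \<omega> - real (d + 1) * s_cond M F A n 2 j \<omega>)))))"
proof -
  interpret prob_space M by fact
  note sets = assms(2)
  have dn: "d \<le> n" using assms(4,5) by simp
  interpret W: pattern_weights n d "\<lambda>S. measure M (pattern_event M A n {S})" "s_num M A n 1" "s_num M A n 2"
    using sets dn by (rule pattern_weights_measure)
  have tail: "measure M (at_least_event M A n k) = W.tail k" for k
    unfolding at_least_event_eq W.tail_def by (rule measure_pattern_event) (use sets in auto)
  have level: "measure M (exactly_event M A n k) = W.level k" for k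
    unfolding exactly_event_eq W.level_def by (rule measure_pattern_event) (use sets in auto)
  show ?thesis
    unfolding tail level
  \<comment> \<open>Cases 1 and 2 belong to (i), 3 and 4 to (ii), 5 and 6 to (iii), 7 to 11 to (iv),
    and 12 to (v).\<close>
  proof (intro conjI impI allI ballI, goal_cases)
    case 1 then show ?case by (intro W.tail_le_s2) simp
  next
    case 2 then show ?case by (intro order_trans[OF W.level_le_tail W.tail_le_s2]) simp
  next
    case 3 then show ?case using assms by (intro W.tail_le) auto
  next
    case 4 then show ?case using assms by (intro W.level_le) auto
  next
    case 5 then show ?case using assms by (intro W.tail_ge) auto
  next
    case 6 then show ?case unfolding W.tail_n[symmetric] using assms by (intro W.tail_ge) auto
  next
    case (7 m) then show ?case by (intro W.tail_d_ge) auto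
  next
    case 8 then show ?case by (intro W.level_d_ge) auto
  next
    case (9 j) then show ?case using assms by (intro W.optimal_exists) auto
  next
    case (10 j m) then show ?case by (intro W.optimal_is_max) auto
  next
    case (11 j m) then show ?case by (intro W.null_is_max) auto
  next
    case (12 F)
    have "AE \<omega> in M. \<forall>Q\<in>Pow (Pow {1..n}).
        0 \<le> cprob M F (pattern_event M A n Q) \<omega> \<and>
        cprob M F (pattern_event M A n Q) \<omega> = (\<Sum>S\<in>Q. cprob M F (pattern_event M A n {S}) \<omega>)"
      using sets 12 by (rule AE_cprob_pattern_event)
    then show ?case
    proof eventually_elim
      case (elim \<omega>)
      have nonneg: "0 \<le> cprob M F (pattern_event M A n Q) \<omega>"
        and add: "cprob M F (pattern_event M A n Q) \<omega> = (\<Sum>S\<in>Q. cprob M F (pattern_event M A n {S}) \<omega>)"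
        if "Q \<subseteq> Pow {1..n}" for Q
        using elim that by blast+
      \<comment> \<open>At a fixed \<open>\<omega>\<close> off the null set the conditional masses
        are weights again, so the bounds hold there for all choices of \<open>m\<close> at
        once.\<close>
      interpret C: pattern_weights n d "\<lambda>S. cprob M F (pattern_event M A n {S}) \<omega>"
        "\<lambda>j. s_cond M F A n 1 j \<omega>" "\<lambda>j. s_cond M F A n 2 j \<omega>"
        by (rule pattern_weights_cprob) (rule nonneg add, assumption)+
      have tail: "cprob M F (at_least_event M A n k) \<omega> = C.tail k" for k
        unfolding at_least_event_eq C.tail_def by (rule add) auto
      have level: "cprob M F (exactly_event M A n k) \<omega> = C.level k" for k
        unfolding exactly_event_eq C.level_def by (rule add) auto
      show ?case
        unfolding tail level
      proof (intro conjI impI allI, goal_cases)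
        case 1 then show ?case by (intro C.tail_le_s2) simp
      next
        case 2 then show ?case by (intro order_trans[OF C.level_le_tail C.tail_le_s2]) simp
      next
        case 3 then show ?case using assms by (intro C.tail_le) auto
      next
        case 4 then show ?case using assms by (intro C.level_le) auto
      next
        case 5 then show ?case using assms by (intro C.tail_ge) auto
      next
        case 6 then show ?case unfolding C.tail_n[symmetric] using assms by (intro C.tail_ge) auto
      next
        case (7 m) then show ?case by (intro C.tail_d_ge) auto
      next
        case 8 then show ?case by (intro C.level_d_ge) auto
      qed
    qed
  qed
qed

end
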